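(* Let $\Omega\subset\mathbb{R}^n$ be a bounded open set and let $f,g\in C(\Omega)$. Suppose $u\in C(\Omega)$ is simultaneously a viscosity solution of $$\frac{\Delta_\infty u}{|Du|^2}=-g(x)\quad\text{and of}\quad\frac{\Delta_\infty u}{|Du|^2}=-f(x)\quad\text{in }\Omega.$$ Then $f=g$ in $\Omega$.
   Context: $\Delta_\infty u=Du\cdot D^2u\cdot Du$. Viscosity solutions of $\frac{\Delta_\infty u}{|Du|^2}=-h(x)$ in $\Omega$, with $h\in C(\Omega)$: $u\in C(\Omega)$ is a viscosity supersolution if for every $x_0\in\Omega$ and $\phi\in C^2(\Omega)$ with $0=\phi(x_0)-u(x_0)\ge\phi(x)-u(x)$ for all $x\in\Omega$, either (1) $D\phi(x_0)\ne0$ and $\Delta_\infty\phi(x_0)\le -h(x_0)|D\phi(x_0)|^2$, or (2) $D\phi(x_0)=0$ and $\min_{|p|=1}p\cdot D^2\phi(x_0)\cdot p\le -h(x_0)$. It is a viscosity subsolution if for every $x_0\in\Omega$ and $\phi\in C^2(\Omega)$ with $0=\phi(x_0)-u(x_0)\le\phi(x)-u(x)$ for all $x\in\Omega$, either (1) $D\phi(x_0)\ne0$ and $\Delta_\infty\phi(x_0)\ge -h(x_0)|D\phi(x_0)|^2$, or (2) $D\phi(x_0)=0$ and $\max_{|p|=1}p\cdot D^2\phi(x_0)\cdot p\ge -h(x_0)$. A viscosity solution is both. *)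

theory Defs
  imports "HOL-Analysis.Analysis"
begin

definition C2_on :: "(real^'n) set \<Rightarrow> (real^'n \<Rightarrow> real) \<Rightarrow> (real^'n \<Rightarrow> real^'n)
    \<Rightarrow> (real^'n \<Rightarrow> real^'n^'n) \<Rightarrow> bool" where
  "C2_on \<Omega> \<phi> D\<phi> D2\<phi> \<longleftrightarrow>
     (\<forall>x\<in>\<Omega>. (\<phi> has_derivative (\<lambda>h. D\<phi> x \<bullet> h)) (at x)) \<and>
     (\<forall>x\<in>\<Omega>. (D\<phi> has_derivative (\<lambda>h. D2\<phi> x *v h)) (at x)) \<and>
     continuous_on \<Omega> D2\<phi>"

definition inf_lap :: "real^'n \<Rightarrow> real^'n^'n \<Rightarrow> real" where
  "inf_lap p A = p \<bullet> (A *v p)"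

definition visc_super :: "(real^'n) set \<Rightarrow> (real^'n \<Rightarrow> real) \<Rightarrow> (real^'n \<Rightarrow> real) \<Rightarrow> bool" where
  "visc_super \<Omega> h u \<longleftrightarrow> continuous_on \<Omega> u \<and>
    (\<forall>x0\<in>\<Omega>. \<forall>\<phi> D\<phi> D2\<phi>. C2_on \<Omega> \<phi> D\<phi> D2\<phi> \<and> \<phi> x0 - u x0 = 0 \<and>
        (\<forall>x\<in>\<Omega>. \<phi> x - u x \<le> 0) \<longrightarrow>
      (D\<phi> x0 \<noteq> 0 \<and> inf_lap (D\<phi> x0) (D2\<phi> x0) \<le> - h x0 * (norm (D\<phi> x0))\<^sup>2) \<or>
      (D\<phi> x0 = 0 \<and> (\<exists>p. norm p = 1 \<and> p \<bullet> (D2\<phi> x0 *v p) \<le> - h x0 \<and>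
          (\<forall>q. norm q = 1 \<longrightarrow> p \<bullet> (D2\<phi> x0 *v p) \<le> q \<bullet> (D2\<phi> x0 *v q)))))"

definition visc_sub :: "(real^'n) set \<Rightarrow> (real^'n \<Rightarrow> real) \<Rightarrow> (real^'n \<Rightarrow> real) \<Rightarrow> bool" where
  "visc_sub \<Omega> h u \<longleftrightarrow> continuous_on \<Omega> u \<and>
    (\<forall>x0\<in>\<Omega>. \<forall>\<phi> D\<phi> D2\<phi>. C2_on \<Omega> \<phi> D\<phi> D2\<phi> \<and> \<phi> x0 - u x0 = 0 \<and>
        (\<forall>x\<in>\<Omega>. \<phi> x - u x \<ge> 0) \<longrightarrow>
      (D\<phi> x0 \<noteq> 0 \<and> inf_lap (D\<phi> x0) (D2\<phi> x0) \<ge> - h x0 * (norm (D\<phi> x0))\<^sup>2) \<or>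
      (D\<phi> x0 = 0 \<and> (\<exists>p. norm p = 1 \<and> p \<bullet> (D2\<phi> x0 *v p) \<ge> - h x0 \<and>
          (\<forall>q. norm q = 1 \<longrightarrow> p \<bullet> (D2\<phi> x0 *v p) \<ge> q \<bullet> (D2\<phi> x0 *v q)))))"

definition visc_sol :: "(real^'n) set \<Rightarrow> (real^'n \<Rightarrow> real) \<Rightarrow> (real^'n \<Rightarrow> real) \<Rightarrow> bool" where
  "visc_sol \<Omega> h u \<longleftrightarrow> visc_super \<Omega> h u \<and> visc_sub \<Omega> h u"

end

theory Submission
  imports Defs
begin

text \<open>
  If \<open>f < g\<close> somewhere, then near that point \<open>u\<close> is a subsolution with right-hand side \<open>c\<close> and a
  supersolution with right-hand side \<open>c' < c\<close>. Comparison with the functions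
  \<open>\<alpha> + \<beta> \<bar>y - x\<bar> + c \<bar>y - x\<bar>\<^sup>2 / 2\<close> makes \<open>max u - c r\<^sup>2 / 2\<close> over the ball \<open>B(x, r)\<close> essentially convex in
  \<open>r\<close>, and similarly for \<open>min u\<close> with \<open>c'\<close>. Hence the slope \<open>W(x, r) = (max u - min u) / (2 r)\<close> grows in
  \<open>r\<close> at a rate of at least \<open>d = (c - c') / 4\<close>.

  Let \<open>x\<close> almost maximise \<open>W(x, \<epsilon>) - K \<bar>x - x\<^sub>0\<bar>\<^sup>2\<close>, and let \<open>x + p\<close>, \<open>x + q\<close> be the extremal points
  of \<open>u\<close> in \<open>B(x, 2 \<epsilon>)\<close>. The midpoints \<open>y = x + p / 2\<close> and \<open>z = x + q / 2\<close> satisfy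
  \<open>W(y, \<epsilon>) + W(z, \<epsilon>) \<ge> 2 W(x, 2 \<epsilon>) \<ge> 2 W(x, \<epsilon>) + 2 d \<epsilon>\<close>, so maximality forces \<open>\<bar>p + q\<bar> \<ge> \<kappa> \<epsilon>\<close> with \<open>\<kappa>\<close>
  independent of \<open>\<epsilon>\<close>. On the other hand the maxima converge as \<open>\<epsilon>\<close> decreases to 0, so \<open>W(x, \<epsilon>)\<close> is nearly
  a Lipschitz constant of \<open>u\<close> near \<open>x\<close>; this makes the extremal points nearly antipodal,
  \<open>p + q = o(\<epsilon>)\<close>, a contradiction. The penalty is centred at a point \<open>x\<^sub>0\<close> whose slopes stay away
  from 0; without such a point \<open>u\<close> would have zero derivative everywhere and be constant.
\<close>

section \<open>Smooth majorants of continuous functions\<close>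

lemma C2_on_add:
  assumes "C2_on S a Da D2a" "C2_on S b Db D2b"
  shows "C2_on S (\<lambda>x. a x + b x) (\<lambda>x. Da x + Db x) (\<lambda>x. D2a x + D2b x)"
  using assms unfolding C2_on_def
  by (auto intro!: has_derivative_eq_rhs[OF has_derivative_add] continuous_on_add
      simp: fun_eq_iff inner_add_left matrix_vector_mult_add_rdistrib)

lemma C2_on_scaleR:
  assumes "C2_on S a Da D2a"
  shows "C2_on S (\<lambda>x. c * a x) (\<lambda>x. c *\<^sub>R Da x) (\<lambda>x. c *\<^sub>R D2a x)"
  using assms unfolding C2_on_def
  by (auto intro!: has_derivative_eq_rhs[OF has_derivative_mult_right]
      has_derivative_eq_rhs[OF has_derivative_scaleR_right] continuous_intros
      simp: fun_eq_iff simp flip: scaleR_matrix_vector_assoc)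

lemma C2_on_zero: "C2_on S (\<lambda>x. 0) (\<lambda>x. 0) (\<lambda>x. 0)"
  unfolding C2_on_def by (auto intro!: derivative_eq_intros)

lemma C2_on_sum:
  assumes "\<And>i. i \<in> I \<Longrightarrow> C2_on S (a i) (Da i) (D2a i)"
  shows "C2_on S (\<lambda>x. \<Sum>i\<in>I. a i x) (\<lambda>x. \<Sum>i\<in>I. Da i x) (\<lambda>x. \<Sum>i\<in>I. D2a i x)"
  using assms
  by (induction I rule: infinite_finite_induct) (auto intro!: C2_on_add C2_on_zero)

lemma C2_on_subset: "C2_on T a Da D2a \<Longrightarrow> S \<subseteq> T \<Longrightarrow> C2_on S a Da D2a"
  unfolding C2_on_def by (auto intro: continuous_on_subset)

text \<open>\<open>C2_on\<close> takes its derivatives with respect to full neighbourhoods, so on an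
  open \<open>S\<close> values off \<open>S\<close> do not matter. A locally finite series thereby
  inherits regularity from its partial sums.\<close>

lemma C2_on_cong_open:
  assumes "C2_on S a Da D2a" "open S"
    and "\<And>x. x \<in> S \<Longrightarrow> b x = a x" "\<And>x. x \<in> S \<Longrightarrow> Db x = Da x" "\<And>x. x \<in> S \<Longrightarrow> D2b x = D2a x"
  shows "C2_on S b Db D2b"
  unfolding C2_on_def
proof (intro conjI ballI)
  fix x assume x: "x \<in> S"
  have "(a has_derivative (\<lambda>h. Db x \<bullet> h)) (at x)" "(Da has_derivative (\<lambda>h. D2b x *v h)) (at x)"
    using assms(1) x unfolding C2_on_def assms(4,5)[OF x] by simp_all
  then show "(b has_derivative (\<lambda>h. Db x \<bullet> h)) (at x)" "(Db has_derivative (\<lambda>h. D2b x *v h)) (at x)"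
    using has_derivative_transform_within_open[OF _ assms(2) x] assms(3,4) by metis+
next
  show "continuous_on S D2b"
    using assms(1) continuous_on_cong[of S S D2b D2a] assms(5) unfolding C2_on_def by metis
qed

section \<open>Radial functions and their second-order data\<close>

definition outer_square :: "real^'n \<Rightarrow> real^'n^'n" where
  "outer_square v = (\<chi> i j. v $ i * v $ j)"

lemma outer_square_mult: "outer_square v *v h = (v \<bullet> h) *\<^sub>R v"
  by (simp add: vec_eq_iff outer_square_def matrix_vector_mult_def inner_vec_def
      sum_distrib_left sum_distrib_right mult_ac)

lemma continuous_on_outer_square [continuous_intros]:
  "continuous_on S f \<Longrightarrow> continuous_on S (\<lambda>x. outer_square (f x))"
  unfolding outer_square_def by (intro continuous_intros)

abbreviation radial_gradient :: "(real \<Rightarrow> real) \<Rightarrow> real^'n \<Rightarrow> real^'n \<Rightarrow> real^'n" where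
  "radial_gradient k1 a x \<equiv> (2 * k1 ((norm (x - a))\<^sup>2)) *\<^sub>R (x - a)"

abbreviation radial_hessian ::
    "(real \<Rightarrow> real) \<Rightarrow> (real \<Rightarrow> real) \<Rightarrow> real^'n \<Rightarrow> real^'n \<Rightarrow> real^'n^'n" where
  "radial_hessian k1 k2 a x \<equiv> (2 * k1 ((norm (x - a))\<^sup>2)) *\<^sub>R mat 1
     + (4 * k2 ((norm (x - a))\<^sup>2)) *\<^sub>R outer_square (x - a)"

text \<open>Expressing radial functions through the squared distance keeps them C2 at the centre
  \<open>a\<close>, where the distance itself is not differentiable. The Hessian is a multiple of
  the identity plus a rank-one term, so inner products suffice to evaluate it.\<close>

lemma C2_on_radial:
  fixes a :: "real^'n"
  assumes k: "\<And>s. (k has_real_derivative k1 s) (at s)"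
    and k1: "\<And>s. (k1 has_real_derivative k2 s) (at s)"
    and k2: "continuous_on UNIV k2"
  shows "C2_on S (\<lambda>x. k ((norm (x - a))\<^sup>2)) (radial_gradient k1 a) (radial_hessian k1 k2 a)"
proof -
  have sq: "((\<lambda>x. (norm (x - a))\<^sup>2) has_derivative (\<lambda>h. 2 * ((x - a) \<bullet> h))) (at x)" for x
    unfolding power2_norm_eq_inner
    by (auto intro!: derivative_eq_intros simp: inner_commute)
  have chain: "((\<lambda>x. q ((norm (x - a))\<^sup>2)) has_derivative
      (\<lambda>h. q' ((norm (x - a))\<^sup>2) * (2 * ((x - a) \<bullet> h)))) (at x)"
    if "\<And>s. (q has_real_derivative q' s) (at s)" for q q' :: "real \<Rightarrow> real" and x
    using has_derivative_compose[OF sq, of q "\<lambda>h. q' ((norm (x - a))\<^sup>2) * h" x]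
      that[of "(norm (x - a))\<^sup>2"]
    by (simp add: has_field_derivative_def)
  have "((\<lambda>x. k ((norm (x - a))\<^sup>2)) has_derivative (\<lambda>h. radial_gradient k1 a x \<bullet> h)) (at x)" for x
    using chain[OF k, of x] by (simp add: mult_ac)
  moreover have "(radial_gradient k1 a has_derivative (\<lambda>h. radial_hessian k1 k2 a x *v h)) (at x)" for x
    by (rule derivative_eq_intros chain[OF k1] refl)+
      (auto simp: matrix_vector_mult_add_rdistrib outer_square_mult
        simp flip: scaleR_matrix_vector_assoc)
  moreover have "continuous_on UNIV k1"
    using k1 by (meson DERIV_isCont continuous_at_imp_continuous_on)
  then have "continuous_on S (\<lambda>x. q ((norm (x - a))\<^sup>2))" if "q \<in> {k1, k2}" for q
    using that k2 by (intro continuous_on_compose2[of UNIV q S]) (auto intro!: continuous_intros)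
  then have "continuous_on S (radial_hessian k1 k2 a)"
    by (auto intro!: continuous_intros)
  ultimately show ?thesis unfolding C2_on_def by blast
qed

text \<open>Only 0 is delicate: there the difference quotient is at most
  \<open>\<bar>h\<bar>\<close> for small \<open>h\<close>, because \<open>n\<close> is at least 2.
  Exponents 3 and 2 serve to differentiate a bump twice.\<close>

lemma max_power_derivative:
  fixes s :: real
  assumes "n \<ge> 2"
  shows "((\<lambda>s. max 0 s ^ n) has_real_derivative (real n * max 0 s ^ (n - 1))) (at s)"
proof (cases "s = 0")
  case True
  have "norm (max 0 h ^ n / h) \<le> \<bar>h\<bar>" if "norm h \<le> 1" for h :: real
  proof (cases "h > 0")
    case True
    have "h ^ n \<le> h ^ 2" using True that assms by (intro power_decreasing) auto
    then show ?thesis using True by (simp add: power2_eq_square field_simps)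
  qed (use assms in \<open>auto simp: power_0_left\<close>)
  moreover have "\<forall>\<^sub>F h in at (0::real). norm h \<le> 1"
    unfolding eventually_at by (intro exI[of _ 1]) auto
  ultimately have "\<forall>\<^sub>F h in at (0::real). norm (max 0 h ^ n / h) \<le> \<bar>h\<bar>"
    by (auto elim: eventually_mono)
  moreover have "((\<lambda>h::real. \<bar>h\<bar>) \<longlongrightarrow> 0) (at 0)"
    by (auto intro!: tendsto_eq_intros)
  ultimately have "((\<lambda>h::real. max 0 h ^ n / h) \<longlongrightarrow> 0) (at 0)"
    by (rule Lim_null_comparison)
  then show ?thesis using True assms by (simp add: DERIV_def power_0_left)
next
  case False
  show ?thesis
  proof (cases "s > 0")
    case True
    have "((\<lambda>s. s ^ n) has_real_derivative (real n * max 0 s ^ (n - 1))) (at s)"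
      using True by (auto intro!: derivative_eq_intros)
    then show ?thesis
      by (rule has_field_derivative_transform_within_open[of _ _ _ "{0<..}"]) (use True in auto)
  next
    case False
    with \<open>s \<noteq> 0\<close> have "s < 0" by simp
    have "((\<lambda>s. 0) has_real_derivative (real n * max 0 s ^ (n - 1))) (at s)"
      using \<open>s < 0\<close> assms by (auto intro!: derivative_eq_intros)
    then show ?thesis
      by (rule has_field_derivative_transform_within_open[of _ _ _ "{..<0}"])
        (use \<open>s < 0\<close> assms in auto)
  qed
qed

section \<open>Bump functions and majorants that vanish at a given point\<close>

text \<open>The cube of the positive part of r^2 - |x - a|^2 works: 3 is the least integer exponent
  for which the second derivative is still continuous.\<close>

lemma C2_bump:
  fixes a :: "real^'n"
  shows "\<exists>\<psi> D D2. C2_on UNIV \<psi> D D2 \<and> (\<forall>x. 0 \<le> \<psi> x) \<and> (\<forall>x \<in> ball a r. 0 < \<psi> x) \<and>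
      (\<forall>x. x \<notin> ball a r \<longrightarrow> \<psi> x = 0 \<and> D x = 0 \<and> D2 x = 0)"
proof (cases "r > 0")
  case True
  define k where "k = (\<lambda>s::real. max 0 (r\<^sup>2 - s) ^ 3)"
  define k1 where "k1 = (\<lambda>s::real. - 3 * max 0 (r\<^sup>2 - s) ^ 2)"
  define k2 where "k2 = (\<lambda>s::real. 6 * max 0 (r\<^sup>2 - s))"
  have "((\<lambda>s. max 0 (r\<^sup>2 - s) ^ n) has_real_derivative - (real n * max 0 (r\<^sup>2 - s) ^ (n - 1))) (at s)"
    if "n \<ge> 2" for n s
  proof -
    have "((\<lambda>s. r\<^sup>2 - s) has_real_derivative -1) (at s)"
      by (auto intro!: derivative_eq_intros)
    from DERIV_chain'[OF this max_power_derivative[OF that, of "r\<^sup>2 - s"]]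
    show ?thesis by simp
  qed
  from this[of 3] DERIV_cmult[OF this[of 2], of "-3"]
  have "(k has_real_derivative k1 s) (at s)" "(k1 has_real_derivative k2 s) (at s)" for s
    unfolding k_def k1_def k2_def by (simp_all add: mult.assoc)
  moreover have "continuous_on UNIV k2"
    unfolding k2_def by (intro continuous_intros)
  ultimately have "C2_on UNIV (\<lambda>x. k ((norm (x - a))\<^sup>2)) (radial_gradient k1 a) (radial_hessian k1 k2 a)"
    by (rule C2_on_radial)
  moreover have "x \<in> ball a r \<longleftrightarrow> (norm (x - a))\<^sup>2 < r\<^sup>2" for x
    using True
    by (metis (no_types) dist_commute dist_norm mem_ball norm_ge_zero order_less_le
        pos2 power_less_imp_less_base power_strict_mono)
  ultimately show ?thesis
    by (intro exI[of _ "\<lambda>x. k ((norm (x - a))\<^sup>2)"] exI[of _ "radial_gradient k1 a"]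
      exI[of _ "radial_hessian k1 k2 a"]) (auto simp: k_def k1_def k2_def max_def)
next
  \<comment> \<open>The ball is empty and the zero function serves. Covering this case lets a bump
    be chosen for every centre, with no condition on the radius.\<close>
  case False
  then show ?thesis using C2_on_zero[of UNIV]
    by (intro exI[of _ "\<lambda>x. 0"]) (auto simp: ball_eq_empty[THEN iffD2])
qed

text \<open>Finitely many bumps supported in \<open>U\<close> cover \<open>C\<close>. Their sum has
  a positive minimum on the compact \<open>C\<close>, so a multiple of it exceeds \<open>B\<close>
  there.\<close>

lemma C2_above_on_compact:
  fixes C U :: "(real^'n) set"
  assumes "compact C" "open U" "C \<subseteq> U"
  shows "\<exists>\<psi> D D2. C2_on UNIV \<psi> D D2 \<and> (\<forall>x. 0 \<le> \<psi> x) \<and> (\<forall>x \<in> C. B \<le> \<psi> x) \<and>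
      (\<forall>x. x \<notin> U \<longrightarrow> \<psi> x = 0 \<and> D x = 0 \<and> D2 x = 0)"
proof -
  have "\<exists>r>0. ball x r \<subseteq> U" if "x \<in> C" for x
    using assms that open_contains_ball by blast
  then obtain r where r: "\<And>x. x \<in> C \<Longrightarrow> r x > 0 \<and> ball x (r x) \<subseteq> U" by metis
  obtain I where I: "I \<subseteq> C" "finite I" "C \<subseteq> (\<Union>x\<in>I. ball x (r x))"
  proof (rule compactE_image[OF assms(1), of C "\<lambda>x. ball x (r x)"])
    show "C \<subseteq> (\<Union>x\<in>C. ball x (r x))" using r by (meson UN_I centre_in_ball subsetI)
  qed auto
  define Q where "Q = (\<lambda>a p D D2. C2_on UNIV p D D2 \<and> (\<forall>x. 0 \<le> p x) \<and>
      (\<forall>x \<in> ball a (r a). 0 < p x) \<and>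
      (\<forall>x. x \<notin> ball a (r a) \<longrightarrow> p x = 0 \<and> D x = 0 \<and> D2 x = 0))"
  have "\<forall>a. \<exists>p D D2. Q a p D D2"
    unfolding Q_def by (intro allI C2_bump)
  then obtain p Dp D2p where "\<And>a. Q a (p a) (Dp a) (D2p a)" by metis
  note p = this[unfolded Q_def]
  define P where "P = (\<lambda>x. \<Sum>a\<in>I. p a x)"
  define DP where "DP = (\<lambda>x. \<Sum>a\<in>I. Dp a x)"
  define D2P where "D2P = (\<lambda>x. \<Sum>a\<in>I. D2p a x)"
  have C2: "C2_on UNIV P DP D2P"
    unfolding P_def DP_def D2P_def using p by (intro C2_on_sum) auto
  have nn: "0 \<le> P x" for x unfolding P_def using p by (auto intro: sum_nonneg)
  have pos: "0 < P x" if x: "x \<in> C" for x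
  proof -
    obtain a where "a \<in> I" "x \<in> ball a (r a)" using I x by blast
    then show ?thesis unfolding P_def using p I by (intro sum_pos2[of I a]) auto
  qed
  have z: "P x = 0 \<and> DP x = 0 \<and> D2P x = 0" if "x \<notin> U" for x
  proof -
    have "x \<notin> ball a (r a)" if "a \<in> I" for a using r I \<open>x \<notin> U\<close> that by blast
    then show ?thesis unfolding P_def DP_def D2P_def using p by simp
  qed
  obtain c where c: "c \<ge> 0" "\<And>x. x \<in> C \<Longrightarrow> B \<le> c * P x"
  proof (cases "C = {}")
    case False
    have "continuous_on C P"
      using C2 unfolding C2_on_def
      by (auto intro!: continuous_at_imp_continuous_on has_derivative_continuous)
    then obtain m where m: "m \<in> C" "\<And>x. x \<in> C \<Longrightarrow> P m \<le> P x"
      using continuous_attains_inf[OF assms(1) False] by blast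
    have "B \<le> (\<bar>B\<bar> / P m) * P x" if "x \<in> C" for x
    proof -
      have "\<bar>B\<bar> * P m \<le> \<bar>B\<bar> * P x" using m that by (intro mult_left_mono) auto
      then have "\<bar>B\<bar> \<le> (\<bar>B\<bar> / P m) * P x" using pos[OF m(1)] by (simp add: field_simps)
      then show ?thesis by linarith
    qed
    then show ?thesis using that[of "\<bar>B\<bar> / P m"] pos[OF m(1)] by auto
  qed (use that[of 0] in auto)
  show ?thesis
    using C2_on_scaleR[OF C2, of c] nn z c by (intro exI[of _ "\<lambda>x. c * P x"] exI conjI) auto
qed

text \<open>Test functions must stay on one side of \<open>u\<close> on all of
  \<open>\<Omega>\<close>, while contact is only checked near a point and \<open>u\<close> may be
  unbounded near the boundary. Adding \<open>\<psi>\<close> repairs a local test function without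
  changing its value, gradient or Hessian at \<open>y\<close>. It is a locally finite sum of
  majorants on compact shells.\<close>

lemma C2_above_continuous:
  fixes \<Omega> :: "(real^'n) set"
  assumes op: "open \<Omega>" and bd: "bounded \<Omega>" and v: "continuous_on \<Omega> v" and s: "s > 0"
  shows "\<exists>\<psi> D D2. C2_on \<Omega> \<psi> D D2 \<and> (\<forall>x\<in>\<Omega>. 0 \<le> \<psi> x) \<and> (\<forall>x \<in> \<Omega> - ball y s. v x \<le> \<psi> x) \<and>
      \<psi> y = 0 \<and> D y = 0 \<and> D2 y = 0"
proof -
  define d where "d = (\<lambda>x. infdist x (- \<Omega>))"
  have "\<Omega> \<noteq> UNIV" using bd not_bounded_UNIV by auto
  then have ne: "- \<Omega> \<noteq> {}" by auto
  have d_pos: "d x > 0 \<longleftrightarrow> x \<in> \<Omega>" for x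
    using in_closed_iff_infdist_zero[of "- \<Omega>" x] ne op infdist_nonneg[of x "- \<Omega>"]
    unfolding d_def by (auto simp: closed_Compl less_le)
  have cd: "continuous_on A d" for A unfolding d_def by (intro continuous_intros)
  \<comment> \<open>The shells are 1/(n+1) <= d <= 1/n; products instead of quotients make the shell
    for n = 0 the region d >= 1. Since \<open>U n\<close> requires n d < 2, only indices below N act
    where N d >= 2. Removing the half-size ball makes all summands vanish to second order at
    \<open>y\<close>.\<close>
  define C where "C = (\<lambda>n::nat. {x. 1 \<le> real (Suc n) * d x} \<inter> {x. real n * d x \<le> 1} - ball y s)"
  define U where "U = (\<lambda>n::nat. {x. real n * d x < 2} - cball y (s/2))"
  have C_sub: "C n \<subseteq> \<Omega>" for n
  proof
    fix x assume "x \<in> C n"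
    then have "0 < real (Suc n) * d x" unfolding C_def by auto
    then have "0 < d x" by (metis of_nat_0_less_iff zero_less_Suc zero_less_mult_pos)
    then show "x \<in> \<Omega>" by (simp add: d_pos)
  qed
  have comp: "compact (C n)" for n
  proof -
    have "closed ({x. 1 \<le> real (Suc n) * d x} \<inter> {x. real n * d x \<le> 1} \<inter> - ball y s)"
      by (intro closed_Int closed_Collect_le continuous_intros cd) auto
    then have "closed (C n)" by (simp add: C_def Diff_eq)
    moreover have "bounded (C n)" using C_sub bd bounded_subset by blast
    ultimately show ?thesis by (simp add: compact_eq_bounded_closed)
  qed
  have opU: "open (U n)" for n
    unfolding U_def by (intro open_Diff open_Collect_less continuous_intros cd) auto
  have CU: "C n \<subseteq> U n" for n unfolding C_def U_def using s by auto
  have "\<exists>B. \<forall>x\<in>C n. v x \<le> B" for n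
  proof -
    have "bounded (v ` C n)"
      by (intro compact_imp_bounded compact_continuous_image continuous_on_subset[OF v C_sub] comp)
    then obtain b where "\<forall>z\<in>v ` C n. \<bar>z\<bar> \<le> b" by (auto simp: bounded_real)
    then show ?thesis by (intro exI[of _ b]) fastforce
  qed
  then obtain B where B: "\<And>n x. x \<in> C n \<Longrightarrow> v x \<le> B n" by metis
  define Q where "Q = (\<lambda>n p D D2. C2_on UNIV p D D2 \<and> (\<forall>x. 0 \<le> p x) \<and>
      (\<forall>x \<in> C n. B n \<le> p x) \<and>
      (\<forall>x. x \<notin> U n \<longrightarrow> p x = 0 \<and> D x = 0 \<and> D2 x = 0))"
  have "\<forall>n. \<exists>p D D2. Q n p D D2"
    unfolding Q_def by (intro allI C2_above_on_compact comp opU CU)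
  then obtain p Dp D2p where "\<And>n. Q n (p n) (Dp n) (D2p n)" by metis
  note p = this[unfolded Q_def]
  define P where "P = (\<lambda>x. \<Sum>n. p n x)"
  define DP where "DP = (\<lambda>x. \<Sum>n. Dp n x)"
  define D2P where "D2P = (\<lambda>x. \<Sum>n. D2p n x)"
  have notU: "x \<notin> U n" if "n \<ge> N" "2 \<le> real N * d x" for n N x
  proof -
    have "d x \<ge> 0" unfolding d_def by (rule infdist_nonneg)
    then have "real N * d x \<le> real n * d x" using that by (intro mult_right_mono) auto
    then show ?thesis using that unfolding U_def by auto
  qed
  have fin: "P x = (\<Sum>n<N. p n x) \<and> DP x = (\<Sum>n<N. Dp n x) \<and> D2P x = (\<Sum>n<N. D2p n x)"
    if "2 \<le> real N * d x" for N x
    unfolding P_def DP_def D2P_def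
    using notU[OF _ that] p by (intro conjI suminf_finite) (auto simp: not_less)
  have exN: "\<exists>N. 2 < real N * d x" if "x \<in> \<Omega>" for x
    using ex_less_of_nat_mult[of "d x" 2] that d_pos by blast
  have local: "C2_on {x. 2 < real N * d x} P DP D2P" for N
  proof (rule C2_on_cong_open)
    show "C2_on {x. 2 < real N * d x} (\<lambda>x. \<Sum>n<N. p n x) (\<lambda>x. \<Sum>n<N. Dp n x) (\<lambda>x. \<Sum>n<N. D2p n x)"
      using p by (intro C2_on_sum) (auto intro: C2_on_subset)
    show "open {x. 2 < real N * d x}"
      by (intro open_Collect_less continuous_intros cd)
  qed (use fin in auto)
  have "C2_on \<Omega> P DP D2P"
    unfolding C2_on_def
  proof (intro conjI ballI)
    fix x assume "x \<in> \<Omega>"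
    then obtain N where N: "2 < real N * d x" using exN by blast
    then show "(P has_derivative (\<lambda>h. DP x \<bullet> h)) (at x)" "(DP has_derivative (\<lambda>h. D2P x *v h)) (at x)"
      using local[of N] unfolding C2_on_def by auto
  next
    have "continuous (at x) D2P" if x: "x \<in> \<Omega>" for x
    proof -
      obtain N where N: "2 < real N * d x" using exN[OF x] by blast
      have "open {x. 2 < real N * d x}"
        by (intro open_Collect_less continuous_intros cd)
      then show ?thesis using local[of N] N unfolding C2_on_def
        by (auto simp: continuous_on_eq_continuous_at)
    qed
    then show "continuous_on \<Omega> D2P" by (simp add: continuous_at_imp_continuous_on)
  qed
  moreover have "0 \<le> P x" if x: "x \<in> \<Omega>" for x
  proof -
    obtain N where "2 < real N * d x" using exN[OF x] by blast
    then show ?thesis using fin[of N x] p by (auto intro: sum_nonneg)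
  qed
  moreover have "v x \<le> P x" if x: "x \<in> \<Omega> - ball y s" for x
  proof -
    obtain N where N: "2 < real N * d x" using exN x by blast
    have dp: "d x > 0" using x d_pos by blast
    define n where "n = nat \<lfloor>1 / d x\<rfloor>"
    have "real n \<le> 1 / d x" "1 / d x < real (Suc n)"
      unfolding n_def using dp by auto linarith
    then have "x \<in> C n" using x dp unfolding C_def by (auto simp: field_simps)
    then have "v x \<le> p n x" using B p by force
    moreover have "n < N"
    proof (rule ccontr)
      assume "\<not> n < N"
      then have "x \<notin> U n" using notU[of N n x] N by simp
      then show False using CU \<open>x \<in> C n\<close> by blast
    qed
    then have "p n x \<le> (\<Sum>n<N. p n x)" using p by (intro member_le_sum) auto
    ultimately show ?thesis using fin[of N x] N by simp
  qed
  moreover have "y \<notin> U n" for n unfolding U_def using s by auto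
  then have "P y = 0" "DP y = 0" "D2P y = 0"
    unfolding P_def DP_def D2P_def using p by auto
  ultimately show ?thesis by (intro exI[of _ P] exI[of _ DP] exI[of _ D2P]) simp
qed

section \<open>Comparison with parabolas of the distance\<close>

text \<open>The previous majorant turns local contact into global contact, and the definition then
  reduces to conditions on the profile \<open>k\<close>. For nonzero gradient, the quotient of
  \<open>inf_lap\<close> by the squared gradient is the second derivative of
  \<open>k (t\<^sup>2)\<close> in the radial variable t. If \<open>k1 \<tau>\<close> vanishes, only
  the rank-one part of the Hessian remains, and \<open>\<theta>\<close> is the squared component of
  \<open>y - a\<close> along the unit vector \<open>p\<close>.\<close>

lemma visc_sub_radial_test:
  fixes \<Omega> :: "(real^'n) set"
  assumes op: "open \<Omega>" and bd: "bounded \<Omega>" and sub: "visc_sub \<Omega> h u" and y: "y \<in> \<Omega>"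
    and k: "\<And>s. (k has_real_derivative k1 s) (at s)"
    and k1: "\<And>s. (k1 has_real_derivative k2 s) (at s)"
    and k2: "continuous_on UNIV k2"
    and s: "s > 0" and eq: "u y = k ((norm (y - a))\<^sup>2)"
    and le: "\<And>x. x \<in> \<Omega> \<inter> ball y s \<Longrightarrow> u x \<le> k ((norm (x - a))\<^sup>2)"
    and \<tau>: "\<tau> = (norm (y - a))\<^sup>2"
  shows "k1 \<tau> \<noteq> 0 \<Longrightarrow> \<tau> \<noteq> 0 \<Longrightarrow> - h y \<le> 2 * k1 \<tau> + 4 * \<tau> * k2 \<tau>"
    and "k1 \<tau> = 0 \<Longrightarrow> \<exists>\<theta>\<in>{0..\<tau>}. - h y \<le> 4 * \<theta> * k2 \<tau>"
proof -
  let ?q = "\<lambda>x. k ((norm (x - a))\<^sup>2)"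
  have C2q: "C2_on \<Omega> ?q (radial_gradient k1 a) (radial_hessian k1 k2 a)"
    by (rule C2_on_radial[OF k k1 k2])
  have cu: "continuous_on \<Omega> u" using sub unfolding visc_sub_def by blast
  have cq: "continuous_on \<Omega> ?q"
    using C2q unfolding C2_on_def
    by (meson continuous_at_imp_continuous_on has_derivative_continuous)
  obtain \<psi> D D2 where C2p: "C2_on \<Omega> \<psi> D D2" and nn: "\<And>x. x \<in> \<Omega> \<Longrightarrow> 0 \<le> \<psi> x"
    and dom: "\<And>x. x \<in> \<Omega> - ball y s \<Longrightarrow> u x - ?q x \<le> \<psi> x"
    and zero: "\<psi> y = 0" "D y = 0" "D2 y = 0"
    using C2_above_continuous[OF op bd continuous_on_diff[OF cu cq] s, of y] by blast
  let ?\<phi> = "\<lambda>x. ?q x + \<psi> x"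
  let ?D = "\<lambda>x. radial_gradient k1 a x + D x"
  let ?H = "\<lambda>x. radial_hessian k1 k2 a x + D2 x"
  have C2: "C2_on \<Omega> ?\<phi> ?D ?H" by (rule C2_on_add[OF C2q C2p])
  have touch: "?\<phi> y - u y = 0" using eq zero by simp
  have above: "\<forall>x\<in>\<Omega>. ?\<phi> x - u x \<ge> 0"
  proof
    fix x assume x: "x \<in> \<Omega>"
    show "?\<phi> x - u x \<ge> 0"
      using le[of x] nn[OF x] dom[of x] x by (cases "x \<in> ball y s") auto
  qed
  let ?A = "radial_hessian k1 k2 a y" and ?g = "radial_gradient k1 a y"
  have Dy: "?D y = ?g" "?H y = ?A" using zero by simp_all
  have test: "(?g \<noteq> 0 \<and> inf_lap ?g ?A \<ge> - h y * (norm ?g)\<^sup>2) \<or>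
      (?g = 0 \<and> (\<exists>p. norm p = 1 \<and> p \<bullet> (?A *v p) \<ge> - h y))"
    using sub[unfolded visc_sub_def, THEN conjunct2, THEN bspec, OF y, THEN spec[of _ ?\<phi>],
        THEN spec[of _ ?D], THEN spec[of _ ?H], THEN mp, OF conjI[OF C2 conjI[OF touch above]]]
    unfolding Dy by (auto simp only:)
  have Ap: "p \<bullet> (?A *v p) = 2 * k1 \<tau> * (p \<bullet> p) + 4 * k2 \<tau> * ((y - a) \<bullet> p)\<^sup>2" for p
    unfolding \<tau>
    by (simp add: matrix_vector_mult_add_rdistrib outer_square_mult inner_add_right
        power2_eq_square inner_commute flip: scaleR_matrix_vector_assoc)
  have ip: "(y - a) \<bullet> (y - a) = \<tau>" by (simp add: \<tau> power2_norm_eq_inner)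
  show "- h y \<le> 2 * k1 \<tau> + 4 * \<tau> * k2 \<tau>" if "k1 \<tau> \<noteq> 0" "\<tau> \<noteq> 0"
  proof -
    have g: "?g = (2 * k1 \<tau>) *\<^sub>R (y - a)" by (simp add: \<tau>)
    have "?g \<noteq> 0" using that unfolding g by (auto simp: \<tau>)
    then have "- h y * (norm ?g)\<^sup>2 \<le> ?g \<bullet> (?A *v ?g)"
      using test unfolding inf_lap_def by blast
    moreover have "(norm ?g)\<^sup>2 = 4 * (k1 \<tau>)\<^sup>2 * \<tau>"
      unfolding power2_norm_eq_inner g by (simp add: ip power2_eq_square)
    moreover have "?g \<bullet> (?A *v ?g) = (4 * (k1 \<tau>)\<^sup>2 * \<tau>) * (2 * k1 \<tau> + 4 * \<tau> * k2 \<tau>)"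
      unfolding Ap unfolding g inner_scaleR_left inner_scaleR_right ip
      by (simp add: power2_eq_square algebra_simps)
    moreover have "4 * (k1 \<tau>)\<^sup>2 * \<tau> > 0"
      using that unfolding \<tau> by (auto intro!: mult_pos_pos)
    ultimately show ?thesis
      by (metis mult.commute mult_le_cancel_left_pos)
  qed
  show "\<exists>\<theta>\<in>{0..\<tau>}. - h y \<le> 4 * \<theta> * k2 \<tau>" if "k1 \<tau> = 0"
  proof -
    have "?g = 0" using that by (simp add: \<tau>)
    then obtain p where p: "norm p = 1" "p \<bullet> (?A *v p) \<ge> - h y" using test by blast
    have "\<bar>(y - a) \<bullet> p\<bar> \<le> norm (y - a)" using Cauchy_Schwarz_ineq2[of "y - a" p] p by simp
    then have "((y - a) \<bullet> p)\<^sup>2 \<le> \<tau>" unfolding \<tau> by (metis abs_ge_zero power2_abs power_mono)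
    then show ?thesis using p(2) that unfolding Ap
      by (intro bexI[of _ "((y - a) \<bullet> p)\<^sup>2"]) (auto simp: mult_ac)
  qed
qed

text \<open>The right-hand side is the parabola in \<open>t\<close> with second derivative
  \<open>c\<close> and values \<open>u x\<close> at 0 and \<open>M\<close> at \<open>r\<close>. If
  \<open>u\<close> exceeded it, the excess would have a positive interior maximum away from
  \<open>x\<close>, where a slightly more convex radial function touches \<open>u\<close> from above
  and violates the subsolution test.\<close>

lemma visc_sub_below_parabola:
  fixes \<Omega> :: "(real^'n) set"
  assumes op: "open \<Omega>" and bd: "bounded \<Omega>" and sub: "visc_sub \<Omega> h u"
    and cb: "cball x r \<subseteq> \<Omega>" and r: "r > 0"
    and c: "\<And>y. y \<in> cball x r \<Longrightarrow> c < - h y"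
    and M: "\<And>y. y \<in> cball x r \<Longrightarrow> u y \<le> M"
    and y: "y \<in> cball x r" and t: "t = norm (y - x)"
  shows "u y \<le> u x + t / r * (M - u x) - c * t * (r - t) / 2"
proof (rule ccontr)
  define b where "b = (M - u x) / r - c * r / 2"
  define G where "G = (\<lambda>t. u x + b * t + c * t\<^sup>2 / 2)"
  have G_eq: "G t = u x + t / r * (M - u x) - c * t * (r - t) / 2" for t
    using r unfolding G_def b_def by (simp add: field_simps power2_eq_square)
  have Gr: "G r = M" using r unfolding G_eq by simp
  assume "\<not> ?thesis"
  then have y_gt: "u y - G (norm (y - x)) > 0" by (simp add: G_eq t)
  have cu: "continuous_on (cball x r) u"
    using sub cb unfolding visc_sub_def by (meson continuous_on_subset)
  have "continuous_on (cball x r) (\<lambda>y. u y - G (norm (y - x)))"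
    unfolding G_def by (intro continuous_intros cu) simp
  then obtain y0 where y0: "y0 \<in> cball x r"
    and max: "\<And>z. z \<in> cball x r \<Longrightarrow> u z - G (norm (z - x)) \<le> u y0 - G (norm (y0 - x))"
    using continuous_attains_sup[of "cball x r" "\<lambda>y. u y - G (norm (y - x))"] r by fastforce
  define m where "m = u y0 - G (norm (y0 - x))"
  define t0 where "t0 = norm (y0 - x)"
  have m: "m > 0" using max[OF y] y_gt unfolding m_def by linarith
  have "y0 \<noteq> x" using m unfolding m_def G_def by auto
  then have t0: "t0 > 0" unfolding t0_def by simp
  have "t0 \<noteq> r" using m M[OF y0] Gr unfolding m_def t0_def by auto
  then have t0r: "t0 < r" using y0 unfolding t0_def by (simp add: dist_norm norm_minus_commute)
  define \<eta> where "\<eta> = (- h y0 - c) / 2"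
  have \<eta>: "\<eta> > 0" "c + \<eta> < - h y0" using c[OF y0] unfolding \<eta>_def by (auto simp: field_simps)
  \<comment> \<open>\<open>A\<close> matches the slope of \<open>G\<close> at \<open>t0\<close>, and
    \<open>E\<close> makes the second derivative of \<open>k (s\<^sup>2)\<close> at
    \<open>t0\<close> equal to \<open>c + \<eta>\<close>, halfway between \<open>c\<close> and
    \<open>- h y0\<close>.\<close>
  define A where "A = (b + c * t0) / (2 * t0)"
  define E where "E = (c + \<eta> - 2 * A) / (8 * t0\<^sup>2)"
  define k where "k = (\<lambda>s. u y0 + A * (s - t0\<^sup>2) + E * (s - t0\<^sup>2)\<^sup>2)"
  define k1 where "k1 = (\<lambda>s. A + 2 * E * (s - t0\<^sup>2))"
  have dk: "(k has_real_derivative k1 s) (at s)" for s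
    unfolding k_def k1_def by (auto intro!: derivative_eq_intros)
  have dk1: "(k1 has_real_derivative 2 * E) (at s)" for s
    unfolding k1_def by (auto intro!: derivative_eq_intros)
  have b_eq: "b = 2 * t0 * A - c * t0" using t0 unfolding A_def by simp
  have E_eq: "8 * t0\<^sup>2 * E = c + \<eta> - 2 * A" using t0 unfolding E_def by simp
  \<comment> \<open>The difference has a double zero at \<open>t0\<close> with leading coefficient
    \<open>\<eta> / 2\<close>, so \<open>k (s\<^sup>2)\<close> lies above \<open>G s + m\<close>
    near \<open>t0\<close>.\<close>
  have diff: "k (s\<^sup>2) - (G s + m) = (s - t0)\<^sup>2 * (\<eta> / 2 + 4 * E * t0 * (s - t0) + E * (s - t0)\<^sup>2)" for s
  proof -
    have "k (s\<^sup>2) - (G s + m) = A * (s\<^sup>2 - t0\<^sup>2) + E * (s\<^sup>2 - t0\<^sup>2)\<^sup>2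
        - b * (s - t0) - c * (s\<^sup>2 - t0\<^sup>2) / 2"
      unfolding k_def m_def G_def t0_def[symmetric] by (simp add: field_simps)
    also have "\<dots> = (s - t0)\<^sup>2 * ((8 * t0\<^sup>2 * E + 2 * A - c) / 2 + 4 * E * t0 * (s - t0) + E * (s - t0)\<^sup>2)"
      unfolding b_eq by (simp add: field_simps power2_eq_square)
    finally show ?thesis unfolding E_eq by simp
  qed
  have "((\<lambda>s. \<eta> / 2 + 4 * E * t0 * (s - t0) + E * (s - t0)\<^sup>2) \<longlongrightarrow> \<eta> / 2) (at t0)"
    by (auto intro!: tendsto_eq_intros)
  then have "\<forall>\<^sub>F s in at t0. \<eta> / 2 + 4 * E * t0 * (s - t0) + E * (s - t0)\<^sup>2 > 0"
    by (rule order_tendstoD(1)) (use \<eta> in simp)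
  then obtain \<delta> where \<delta>: "\<delta> > 0"
    "\<And>s. s \<noteq> t0 \<Longrightarrow> dist s t0 < \<delta> \<Longrightarrow> \<eta> / 2 + 4 * E * t0 * (s - t0) + E * (s - t0)\<^sup>2 > 0"
    unfolding eventually_at by auto
  have kG: "G s + m \<le> k (s\<^sup>2)" if "dist s t0 < \<delta>" for s
  proof (cases "s = t0")
    case False
    then show ?thesis using diff[of s] \<delta>(2)[OF False that] by (smt (verit) mult_nonneg_nonneg zero_le_power2)
  qed (use diff[of s] in simp)
  define s where "s = min \<delta> (r - t0)"
  have s: "s > 0" using \<delta> t0r unfolding s_def by simp
  have "u z \<le> k ((norm (z - x))\<^sup>2)" if z: "z \<in> \<Omega> \<inter> ball y0 s" for z
  proof -
    have zs: "norm (z - y0) < s" using z by (simp add: dist_norm norm_minus_commute)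
    have n: "\<bar>norm (z - x) - t0\<bar> \<le> norm (z - y0)"
      using norm_triangle_ineq3[of "z - x" "y0 - x"] unfolding t0_def by simp
    then have "dist (norm (z - x)) t0 < \<delta>" "norm (z - x) < r"
      using zs unfolding s_def dist_real_def by auto
    moreover from this have "u z - G (norm (z - x)) \<le> m"
      using max[of z] unfolding m_def by (simp add: dist_norm norm_minus_commute)
    ultimately show ?thesis using kG[of "norm (z - x)"] by linarith
  qed
  note test = visc_sub_radial_test[OF op bd sub subsetD[OF cb y0] dk dk1 continuous_on_const s _ this, of "t0\<^sup>2"]
  have u0: "u y0 = k ((norm (y0 - x))\<^sup>2)" unfolding k_def t0_def by simp
  have k1_0: "k1 (t0\<^sup>2) = A" unfolding k1_def by simp
  show False
  proof (cases "A = 0")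
    case False
    then have "- h y0 \<le> 2 * A + 4 * t0\<^sup>2 * (2 * E)"
      using test(1)[OF u0] k1_0 t0 by (simp add: t0_def)
    then show False using E_eq \<eta> by simp
  next
    \<comment> \<open>The gradient vanishes, so the test only bounds \<open>- h y0\<close> with some
      unknown \<open>\<theta>\<close> up to \<open>t0\<^sup>2\<close>. For \<open>c \<ge> 0\<close>
      the coefficient \<open>E\<close> is nonnegative and the worst \<open>\<theta>\<close> gives
      \<open>c + \<eta>\<close> again.\<close>
    case True
    then obtain \<theta> where \<theta>: "0 \<le> \<theta>" "\<theta> \<le> t0\<^sup>2" "- h y0 \<le> 4 * \<theta> * (2 * E)"
      using test(2)[OF u0] k1_0 by (auto simp: t0_def)
    show False
    proof (cases "c \<ge> 0")
      case True
      have "8 * E * t0\<^sup>2 = c + \<eta>" using E_eq \<open>A = 0\<close> by (simp add: mult_ac)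
      then have "E \<ge> 0" using True \<eta> t0 by (smt (verit) mult_nonpos_nonneg zero_le_power2)
      then have "\<theta> * (8 * E) \<le> t0\<^sup>2 * (8 * E)" using \<theta> by (intro mult_right_mono) auto
      then show False using \<theta> E_eq \<eta> \<open>A = 0\<close> by (simp add: mult_ac)
    next
      case False
      \<comment> \<open>A concave parabola with vertex at \<open>t0\<close> lies above its value \<open>M\<close> at \<open>r\<close>.\<close>
      have "G t0 - G r = - c * (r - t0)\<^sup>2 / 2"
        using b_eq \<open>A = 0\<close> unfolding G_def by (simp add: field_simps power2_eq_square)
      moreover have "- c * (r - t0)\<^sup>2 / 2 \<ge> 0" using False by (simp add: mult_nonpos_nonneg)
      ultimately have "G t0 \<ge> M" using Gr by simp
      then show False using m M[OF y0] unfolding m_def t0_def by simp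
    qed
  qed
qed

text \<open>This upgrades the pointwise parabola bound to the whole ball of radius
  \<open>\<rho>\<close>, which needs a substitute for monotonicity of \<open>G\<close> on
  \<open>[0, \<rho>]\<close>. The convex and concave cases require different arguments.\<close>

lemma visc_sub_max_growth:
  fixes \<Omega> :: "(real^'n) set"
  assumes op: "open \<Omega>" and bd: "bounded \<Omega>" and sub: "visc_sub \<Omega> h u"
    and cb: "cball x r \<subseteq> \<Omega>" and \<rho>: "0 < \<rho>" "\<rho> \<le> r"
    and c: "\<And>y. y \<in> cball x r \<Longrightarrow> c < - h y"
    and M: "\<And>y. y \<in> cball x r \<Longrightarrow> u y \<le> M"
    and y: "y \<in> cball x \<rho>"
  shows "u y \<le> u x + \<rho> / r * (M - u x) - c * \<rho> * (r - \<rho>) / 2"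
proof -
  have r: "r > 0" using \<rho> by simp
  define b where "b = (M - u x) / r - c * r / 2"
  define G where "G = (\<lambda>t. u x + b * t + c * t\<^sup>2 / 2)"
  have G_eq: "G t = u x + t / r * (M - u x) - c * t * (r - t) / 2" for t
    using r unfolding G_def b_def by (simp add: field_simps power2_eq_square)
  have Gr: "G r = M" using r unfolding G_eq by simp
  have Mx: "u x \<le> M" using M[of x] r by simp
  have below: "u z \<le> G (norm (z - x))" if "z \<in> cball x r" for z
    unfolding G_eq using visc_sub_below_parabola[OF op bd sub cb r c M that refl] .
  define t where "t = norm (y - x)"
  have t: "0 \<le> t" "t \<le> \<rho>" using y unfolding t_def by (auto simp: dist_norm norm_minus_commute)
  have yr: "y \<in> cball x r" using y \<rho> by auto
  have "u y \<le> G \<rho>"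
  proof (cases "c \<ge> 0")
    case True
    \<comment> \<open>Otherwise \<open>x\<close> would be a local maximum, and a constant test
      function would give \<open>- h x \<le> 0\<close>, against
      \<open>0 \<le> c < - h x\<close>.\<close>
    have "u x \<le> G \<rho>"
    proof (rule ccontr)
      assume "\<not> u x \<le> G \<rho>"
      moreover have "G \<rho> = u x + (b + c * \<rho> / 2) * \<rho>"
        unfolding G_def by (simp add: power2_eq_square algebra_simps)
      ultimately have "(b + c * \<rho> / 2) * \<rho> < 0" by simp
      then have neg: "b + c * \<rho> / 2 < 0"
        using \<rho>(1) by (simp add: mult_less_0_iff)
      have "u z \<le> u x" if z: "z \<in> \<Omega> \<inter> ball x \<rho>" for z
      proof -
        have n: "norm (z - x) \<le> \<rho>" using z by (auto simp: dist_norm norm_minus_commute)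
        have "c * norm (z - x) \<le> c * \<rho>" using n True by (intro mult_left_mono) auto
        then have "(b + c * norm (z - x) / 2) * norm (z - x) \<le> 0"
          using neg by (intro mult_nonpos_nonneg) auto
        then show ?thesis using below[of z] z \<rho> unfolding G_def
          by (auto simp: power2_eq_square algebra_simps)
      qed
      then have "\<exists>\<theta>\<in>{0..(norm (x - x))\<^sup>2}. - h x \<le> 4 * \<theta> * 0"
        using cb r
        by (intro visc_sub_radial_test(2)[OF op bd sub _ DERIV_const[of "u x"] DERIV_const[of 0] continuous_on_const \<rho>(1)])
          auto
      then show False using c[of x] r True by simp
    qed
    moreover have "G t \<le> max (G 0) (G \<rho>)"
    proof -
      have "G t \<le> G 0 + t / \<rho> * (G \<rho> - G 0)"
      proof -
        have "G 0 + t / \<rho> * (G \<rho> - G 0) - G t = c * t * (\<rho> - t) / 2"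
          using \<rho> unfolding G_def by (simp add: field_simps power2_eq_square)
        moreover have "c * t * (\<rho> - t) \<ge> 0" using True t by simp
        ultimately show ?thesis by linarith
      qed
      also have "\<dots> = (1 - t / \<rho>) * G 0 + t / \<rho> * G \<rho>" by (simp add: algebra_simps)
      also have "\<dots> \<le> max (G 0) (G \<rho>)"
        using t \<rho> by (intro convex_bound_le) auto
      finally show ?thesis .
    qed
    moreover have "G 0 = u x" unfolding G_def by simp
    ultimately show ?thesis using below[OF yr] unfolding t_def by simp
  next
    case False
    show ?thesis
    \<comment> \<open>The sign of the slope of the concave \<open>G\<close> at \<open>\<rho>\<close>
      decides: either \<open>G\<close> increases up to \<open>\<rho>\<close>, or it decreases from
      \<open>\<rho>\<close> to \<open>r\<close> and already dominates
      \<open>M = G r\<close>.\<close>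
    proof (cases "b + c * \<rho> \<ge> 0")
      case True
      have "c * \<rho> \<le> c * t" using t False by (intro mult_left_mono_neg) auto
      then have "(\<rho> - t) * (b + c * (\<rho> + t) / 2) \<ge> 0"
        using True t by (intro mult_nonneg_nonneg) (auto simp: field_simps)
      moreover have "G \<rho> - G t = (\<rho> - t) * (b + c * (\<rho> + t) / 2)"
        unfolding G_def by (simp add: field_simps power2_eq_square)
      ultimately show ?thesis using below[OF yr] unfolding t_def by simp
    next
      case neg: False
      have "c * r \<le> c * \<rho>" using \<rho> False by (intro mult_left_mono_neg) auto
      then have "(r - \<rho>) * (b + c * (r + \<rho>) / 2) \<le> 0"
        using neg \<rho> by (intro mult_nonneg_nonpos) (auto simp: field_simps)
      moreover have "G r - G \<rho> = (r - \<rho>) * (b + c * (r + \<rho>) / 2)"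
        unfolding G_def by (simp add: field_simps power2_eq_square)
      ultimately show ?thesis using M[OF yr] Gr by simp
    qed
  qed
  then show ?thesis unfolding G_eq .
qed

text \<open>Negating test functions exchanges the minimum and maximum over unit directions. Bounds
  for maxima of subsolutions thus become bounds for minima of supersolutions.\<close>

lemma visc_super_imp_visc_sub_uminus:
  fixes \<Omega> :: "(real^'n) set"
  assumes "visc_super \<Omega> h u"
  shows "visc_sub \<Omega> (\<lambda>x. - h x) (\<lambda>x. - u x)"
  unfolding visc_sub_def
proof (intro conjI ballI allI impI)
  show "continuous_on \<Omega> (\<lambda>x. - u x)"
    using assms unfolding visc_super_def by (auto intro: continuous_on_minus)
next
  fix x0 and \<phi> :: "real^'n \<Rightarrow> real" and D D2
  assume x0: "x0 \<in> \<Omega>"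
    and *: "C2_on \<Omega> \<phi> D D2 \<and> \<phi> x0 - - u x0 = 0 \<and> (\<forall>x\<in>\<Omega>. 0 \<le> \<phi> x - - u x)"
  have "C2_on \<Omega> (\<lambda>x. - \<phi> x) (\<lambda>x. - D x) (\<lambda>x. - D2 x)"
    using C2_on_scaleR[of \<Omega> \<phi> D D2 "-1"] * by simp
  moreover have "- \<phi> x0 - u x0 = 0" "\<forall>x\<in>\<Omega>. - \<phi> x - u x \<le> 0" using * by auto
  ultimately have C2: "C2_on \<Omega> (\<lambda>x. - \<phi> x) (\<lambda>x. - D x) (\<lambda>x. - D2 x) \<and>
      - \<phi> x0 - u x0 = 0 \<and> (\<forall>x\<in>\<Omega>. - \<phi> x - u x \<le> 0)" by blast
  have "(- D x0 \<noteq> 0 \<and> inf_lap (- D x0) (- D2 x0) \<le> - h x0 * (norm (- D x0))\<^sup>2) \<or>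
      (- D x0 = 0 \<and> (\<exists>p. norm p = 1 \<and> p \<bullet> (- D2 x0 *v p) \<le> - h x0 \<and>
          (\<forall>q. norm q = 1 \<longrightarrow> p \<bullet> (- D2 x0 *v p) \<le> q \<bullet> (- D2 x0 *v q))))"
    using assms[unfolded visc_super_def, THEN conjunct2, THEN bspec, OF x0, THEN spec, THEN spec,
        THEN spec, THEN mp, OF C2] .
  moreover have neg: "(- A) *v p = - (A *v p)" for A :: "real^'n^'n" and p
    using scaleR_matrix_vector_assoc[of "-1" A p] by simp
  moreover have "A *v (- p) = - (A *v p)" for A :: "real^'n^'n" and p
    using matrix_vector_mult_scaleR[of A "-1" p] by simp
  ultimately show "D x0 \<noteq> 0 \<and> - (- h x0) * (norm (D x0))\<^sup>2 \<le> inf_lap (D x0) (D2 x0) \<or>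
       D x0 = 0 \<and> (\<exists>p. norm p = 1 \<and> - (- h x0) \<le> p \<bullet> (D2 x0 *v p) \<and>
         (\<forall>q. norm q = 1 \<longrightarrow> q \<bullet> (D2 x0 *v q) \<le> p \<bullet> (D2 x0 *v p)))"
    unfolding inf_lap_def by (simp add: inner_minus_left inner_minus_right)
qed

section \<open>Oscillation slopes\<close>

definition osc_slope :: "('a::metric_space \<Rightarrow> real) \<Rightarrow> 'a \<Rightarrow> real \<Rightarrow> real" where
  "osc_slope u x r = (Sup (u ` cball x r) - Inf (u ` cball x r)) / (2 * r)"

lemma osc_slope_attained:
  fixes u :: "'a::heine_borel \<Rightarrow> real"
  assumes "continuous_on (cball x r) u" "r > 0"
  obtains y z where "y \<in> cball x r" "z \<in> cball x r" "u y - u z = 2 * r * osc_slope u x r"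
    "\<And>v. v \<in> cball x r \<Longrightarrow> u v \<le> u y" "\<And>v. v \<in> cball x r \<Longrightarrow> u z \<le> u v"
proof -
  have ne: "cball x r \<noteq> {}" using assms by auto
  obtain y where y: "y \<in> cball x r" "\<And>v. v \<in> cball x r \<Longrightarrow> u v \<le> u y"
    using continuous_attains_sup[OF compact_cball ne assms(1)] by blast
  obtain z where z: "z \<in> cball x r" "\<And>v. v \<in> cball x r \<Longrightarrow> u z \<le> u v"
    using continuous_attains_inf[OF compact_cball ne assms(1)] by blast
  have "Sup (u ` cball x r) = u y" "Inf (u ` cball x r) = u z"
    using y z by (auto intro!: cSup_eq_maximum cInf_eq_minimum simp del: mem_cball)
  then show ?thesis using that[OF y(1) z(1) _ y(2) z(2)] assms by (simp add: osc_slope_def)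
qed

lemma diff_le_osc_slope:
  fixes u :: "'a::heine_borel \<Rightarrow> real"
  assumes "continuous_on (cball x r) u" "r > 0" "y \<in> cball x r" "z \<in> cball x r"
  shows "u y - u z \<le> 2 * r * osc_slope u x r"
  by (rule osc_slope_attained[OF assms(1,2)]) (use assms(3,4) in \<open>smt (verit)\<close>)

text \<open>Add the growth bounds for \<open>u\<close> and for \<open>- u\<close>: the values at the
  centre cancel, leaving only the oscillation. Dividing by \<open>2 * \<rho>\<close> yields the rate
  \<open>(c - c') / 4\<close>.\<close>

lemma visc_osc_slope_growth:
  fixes \<Omega> :: "(real^'n) set"
  assumes op: "open \<Omega>" and bd: "bounded \<Omega>" and sub: "visc_sub \<Omega> h u" and sup: "visc_super \<Omega> h' u"
    and cb: "cball x r \<subseteq> \<Omega>" and \<rho>: "0 < \<rho>" "\<rho> \<le> r"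
    and c: "\<And>y. y \<in> cball x r \<Longrightarrow> c < - h y" and c': "\<And>y. y \<in> cball x r \<Longrightarrow> - h' y < c'"
  shows "osc_slope u x \<rho> + (c - c') / 4 * (r - \<rho>) \<le> osc_slope u x r"
proof -
  have r: "r > 0" using \<rho> by simp
  have sub\<rho>: "cball x \<rho> \<subseteq> cball x r" using \<rho> by auto
  have cu: "continuous_on (cball x r) u"
    using sub cb unfolding visc_sub_def by (blast intro: continuous_on_subset)
  obtain y z where yz: "y \<in> cball x \<rho>" "z \<in> cball x \<rho>" "u y - u z = 2 * \<rho> * osc_slope u x \<rho>"
    using osc_slope_attained[OF continuous_on_subset[OF cu sub\<rho>] \<rho>(1)] by metis
  obtain Y Z where YZ: "u Y - u Z = 2 * r * osc_slope u x r"
    "\<And>v. v \<in> cball x r \<Longrightarrow> u v \<le> u Y" "\<And>v. v \<in> cball x r \<Longrightarrow> u Z \<le> u v"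
    using osc_slope_attained[OF cu r] by metis
  have 1: "u y \<le> u x + \<rho> / r * (u Y - u x) - c * \<rho> * (r - \<rho>) / 2"
    by (rule visc_sub_max_growth[OF op bd sub cb \<rho> c YZ(2) yz(1)])
  have 2: "- u z \<le> - u x + \<rho> / r * (- u Z - - u x) - (- c') * \<rho> * (r - \<rho>) / 2"
    by (rule visc_sub_max_growth[OF op bd visc_super_imp_visc_sub_uminus[OF sup] cb \<rho> _ _ yz(2)])
      (use c' YZ(3) in force)+
  have "2 * \<rho> * osc_slope u x \<rho> \<le> \<rho> / r * (u Y - u Z) - (c - c') * \<rho> * (r - \<rho>) / 2"
    using 1 2 unfolding yz(3)[symmetric] by (simp add: algebra_simps diff_divide_distrib add_divide_distrib)
  also have "\<dots> = 2 * \<rho> * (osc_slope u x r - (c - c') / 4 * (r - \<rho>))"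
    unfolding YZ(1) using r by (simp add: field_simps)
  finally show ?thesis using \<rho>(1) by simp
qed

section \<open>Incompatibility of strict slope growth with a positive limiting slope\<close>

text \<open>No equation enters here: slope growth and one centre with slopes at least
  \<open>\<Lambda>\<close> are already contradictory. Two opposite estimates of \<open>p + q\<close>
  are compared at a single small scale \<open>\<epsilon>\<close>.\<close>

lemma osc_slope_growth_contradiction:
  fixes u :: "'a::euclidean_space \<Rightarrow> real"
  assumes R: "R > 0" and d: "d > 0" and \<Lambda>: "\<Lambda> > 0"
    and cont: "continuous_on (cball x0 (2 * R)) u"
    and growth: "\<And>x \<rho> r. x \<in> cball x0 R \<Longrightarrow> 0 < \<rho> \<Longrightarrow> \<rho> \<le> r \<Longrightarrow> r \<le> R \<Longrightarrow>
      osc_slope u x \<rho> + d * (r - \<rho>) \<le> osc_slope u x r"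
    and low: "\<And>r. 0 < r \<Longrightarrow> r \<le> R \<Longrightarrow> \<Lambda> \<le> osc_slope u x0 r"
  shows False
proof -
  let ?W = "osc_slope u"
  have sub: "cball x r \<subseteq> cball x0 (2 * R)" if "x \<in> cball x0 R" "r \<le> R" for x r
  proof
    fix v assume "v \<in> cball x r"
    then show "v \<in> cball x0 (2 * R)" using that dist_triangle[of x0 v x] by auto
  qed
  have cu: "continuous_on (cball x r) u" if "x \<in> cball x0 R" "r \<le> R" for x r
    using cont sub[OF that] by (rule continuous_on_subset)
  have mono: "?W x \<rho> \<le> ?W x r" if "x \<in> cball x0 R" "0 < \<rho>" "\<rho> \<le> r" "r \<le> R" for x \<rho> r
    using growth[OF that] d that by (smt (verit) mult_nonneg_nonneg)
  obtain B where B: "B > 0" "\<And>v. v \<in> cball x0 (2 * R) \<Longrightarrow> \<bar>u v\<bar> \<le> B"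
    using compact_imp_bounded[OF compact_continuous_image[OF cont compact_cball]]
    unfolding bounded_pos by (auto simp del: mem_cball)
  have W_le: "?W x r \<le> B / R" if xr: "x \<in> cball x0 R" "0 < r" "r \<le> R" for x r
  proof -
    obtain y z where yz: "y \<in> cball x R" "z \<in> cball x R" "u y - u z = 2 * R * ?W x R"
      using osc_slope_attained[OF cu[OF xr(1) order_refl] R] by metis
    then have "2 * R * ?W x R \<le> 2 * B"
      using B(2)[of y] B(2)[of z] sub[OF xr(1) order_refl] by (smt (verit) subsetD)
    then have "?W x R \<le> B / R" using R by (simp add: field_simps)
    then show ?thesis using mono[OF xr order_refl] by simp
  qed
  \<comment> \<open>At distance \<open>R / 2\<close> the penalty equals \<open>B / R + 1\<close>,
    more than any slope. Near-maximisers therefore stay in the half-size ball, leaving room for the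
    balls used below.\<close>
  define K where "K = 4 * (B / R + 1) / R\<^sup>2"
  have K: "K > 0" unfolding K_def using B R by (auto intro!: divide_pos_pos add_pos_pos)
  define F where "F = (\<lambda>e x. ?W x e - K * (norm (x - x0))\<^sup>2)"
  define A where "A = (\<lambda>e. Sup (F e ` cball x0 R))"
  have F_le_W: "F e x \<le> ?W x e" for e x unfolding F_def using K by simp
  have bdd: "bdd_above (F e ` cball x0 R)" if "0 < e" "e \<le> R" for e
    using W_le[OF _ that] F_le_W[of e] by (intro bdd_aboveI2[of _ _ "B / R"]) (rule order_trans)
  have F_le_A: "F e x \<le> A e" if "0 < e" "e \<le> R" "x \<in> cball x0 R" for e x
    unfolding A_def using bdd[OF that(1,2)] that(3) by (intro cSup_upper) auto
  have ne: "F e ` cball x0 R \<noteq> {}" for e using R by auto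
  have A_mono: "A e \<le> A e'" if "0 < e" "e \<le> e'" "e' \<le> R" for e e'
    unfolding A_def
  proof (rule cSup_least[OF ne])
    fix t assume "t \<in> F e ` cball x0 R"
    then obtain x where x: "x \<in> cball x0 R" "t = F e x" by blast
    have "t \<le> F e' x" using mono[OF x(1) that] x(2) unfolding F_def by simp
    also have "\<dots> \<le> A e'" using F_le_A x(1) that by simp
    finally show "t \<le> Sup (F e' ` cball x0 R)" unfolding A_def .
  qed
  have A_ge: "\<Lambda> \<le> A e" if "0 < e" "e \<le> R" for e
    using F_le_A[OF that, of x0] low[OF that] R unfolding F_def by simp
  define \<kappa> where "\<kappa> = d / (K * R)"
  have \<kappa>: "\<kappa> > 0" unfolding \<kappa>_def using d K R by simp
  \<comment> \<open>The factor 400 makes the final comparison strict, where the constant 24 * 8 /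
    400 < 1 appears. The bound \<open>\<Lambda> / 2\<close> keeps the slope \<open>w\<close> at
    least \<open>\<Lambda> / 2\<close>.\<close>
  define \<eta> where "\<eta> = min (\<Lambda> * \<kappa>\<^sup>2 / 400) (\<Lambda> / 2)"
  have \<eta>: "\<eta> > 0" "\<eta> \<le> \<Lambda> * \<kappa>\<^sup>2 / 400" "\<eta> \<le> \<Lambda> / 2" unfolding \<eta>_def using \<Lambda> \<kappa> by auto
  have "\<exists>t\<in>A ` {0<..R}. t < Inf (A ` {0<..R}) + \<eta>"
    using R \<eta> by (intro cInf_lessD) auto
  \<comment> \<open>\<open>A\<close> is monotone and bounded below by \<open>\<Lambda>\<close>, so
    from some radius \<open>r\<close> downwards it varies by at most \<open>\<eta>\<close>.\<close>
  then obtain r where r: "0 < r" "r \<le> R" "A r < Inf (A ` {0<..R}) + \<eta>" by auto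
  have A_r: "A r \<le> A e + \<eta>" if "0 < e" "e \<le> R" for e
  proof -
    have "Inf (A ` {0<..R}) \<le> A e"
      using that A_ge by (intro cInf_lower bdd_belowI[of _ \<Lambda>]) auto
    then show ?thesis using r by simp
  qed
  \<comment> \<open>In order, the bounds allow comparison with radius \<open>r\<close>, keep all
    centres in \<open>cball x0 R\<close>, absorb the quadratic part of the penalty, limit the change
    of the penalty by \<open>\<eta>\<close>, and give \<open>\<theta> \<le> \<eta>\<close>.\<close>
  define \<epsilon> where "\<epsilon> = Min {r / 2, R / 4, d / (4 * K), \<eta> / (4 * K * R), 4 * \<eta> / d}"
  have \<epsilon>: "\<epsilon> > 0" unfolding \<epsilon>_def using r R d K \<eta> by auto
  have "\<epsilon> \<le> r / 2" "\<epsilon> \<le> R / 4" "\<epsilon> \<le> d / (4 * K)" "\<epsilon> \<le> \<eta> / (4 * K * R)" "\<epsilon> \<le> 4 * \<eta> / d"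
    unfolding \<epsilon>_def by (auto intro: Min_le)
  then have \<epsilon>_le: "2 * \<epsilon> \<le> r" "4 * \<epsilon> \<le> R" "4 * K * \<epsilon> \<le> d" "4 * K * R * \<epsilon> \<le> \<eta>" "d * \<epsilon> / 4 \<le> \<eta>"
    using K R d by (auto simp: field_simps)
  \<comment> \<open>The supremum of \<open>F \<epsilon>\<close> is only approached. The slack is a
    quarter of the gain \<open>d * \<epsilon>\<close>, so it can be absorbed.\<close>
  define \<theta> where "\<theta> = d * \<epsilon> / 4"
  have \<theta>: "\<theta> > 0" "\<theta> \<le> \<eta>" unfolding \<theta>_def using d \<epsilon> \<epsilon>_le by auto
  have \<epsilon>R: "\<epsilon> \<le> R" using \<epsilon>_le \<epsilon> by linarith
  obtain x where x: "x \<in> cball x0 R" "A \<epsilon> - \<theta> < F \<epsilon> x"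
    using less_cSupD[OF ne, of "A \<epsilon> - \<theta>" \<epsilon>] \<theta> unfolding A_def by auto
  define w where "w = ?W x \<epsilon>"
  have Fx: "F \<epsilon> x \<ge> \<Lambda> / 2" using x A_ge[OF \<epsilon> \<epsilon>R] \<theta> \<eta> by linarith
  then have w: "w \<ge> \<Lambda> / 2" using F_le_W[of \<epsilon> x] unfolding w_def by linarith
  have xR: "norm (x - x0) \<le> R / 2"
  proof (rule ccontr)
    assume "\<not> ?thesis"
    then have "(R / 2)\<^sup>2 \<le> (norm (x - x0))\<^sup>2" using R by (intro power_mono) auto
    then have "K * (R / 2)\<^sup>2 \<le> K * (norm (x - x0))\<^sup>2" using K by (intro mult_left_mono) auto
    moreover have "K * (R / 2)\<^sup>2 = B / R + 1" unfolding K_def using R by (simp add: power_divide)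
    ultimately show False using Fx W_le[OF x(1) \<epsilon> \<epsilon>R] \<Lambda> unfolding F_def by linarith
  qed
  have near: "v \<in> cball x0 R" if "norm (v - x) \<le> 2 * \<epsilon>" for v
    using norm_triangle_ineq[of "v - x" "x - x0"] that xR \<epsilon>_le by (simp add: dist_norm norm_minus_commute)
  have 2: "0 < 2 * \<epsilon>" "2 * \<epsilon> \<le> R" using \<epsilon> \<epsilon>_le by auto
  obtain y2 z2 where yz2: "y2 \<in> cball x (2 * \<epsilon>)" "z2 \<in> cball x (2 * \<epsilon>)"
    "u y2 - u z2 = 2 * (2 * \<epsilon>) * ?W x (2 * \<epsilon>)"
    using osc_slope_attained[OF cu[OF x(1) 2(2)] 2(1)] by metis
  define p where "p = y2 - x"
  define q where "q = z2 - x"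
  have pq: "norm p \<le> 2 * \<epsilon>" "norm q \<le> 2 * \<epsilon>"
    using yz2 unfolding p_def q_def by (auto simp: dist_norm norm_minus_commute)
  have gain: "w + d * \<epsilon> \<le> ?W x (2 * \<epsilon>)"
    using growth[OF x(1) \<epsilon>, of "2 * \<epsilon>"] \<epsilon> 2 unfolding w_def by simp
  have half: "v - v /\<^sub>R 2 = v /\<^sub>R 2" for v :: 'a
    using scaleR_left_diff_distrib[of 1 "1 / 2" v] by simp
  have yz2_eq: "y2 = x + p" "z2 = x + q" unfolding p_def q_def by simp_all
  \<comment> \<open>Maximality of \<open>x\<close> against the midpoints towards the extremal points forces \<open>p + q\<close> to be comparable to \<open>\<epsilon>\<close>.\<close>
  have lower: "\<kappa> * \<epsilon> \<le> norm (p + q)"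
  proof -
    define y where "y = x + p /\<^sub>R 2"
    define z where "z = x + q /\<^sub>R 2"
    have yzX: "y \<in> cball x0 R" "z \<in> cball x0 R"
      using pq \<epsilon> by (auto intro!: near simp: y_def z_def simp del: mem_cball)
    have "y2 - y = p /\<^sub>R 2" "z2 - z = q /\<^sub>R 2"
      unfolding y_def z_def yz2_eq using half[of p] half[of q] by simp_all
    then have in_y: "y2 \<in> cball y \<epsilon>" "x \<in> cball y \<epsilon>" and in_z: "z2 \<in> cball z \<epsilon>" "x \<in> cball z \<epsilon>"
      using pq unfolding mem_cball dist_norm norm_minus_commute[of y] norm_minus_commute[of z]
      by (auto simp: y_def z_def)
    \<comment> \<open>To first order the two penalty increments depend only on \<open>p + q\<close>;
      the rest is of order \<open>\<epsilon>\<^sup>2\<close>.\<close>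
    have sq: "(norm (y - x0))\<^sup>2 + (norm (z - x0))\<^sup>2 - 2 * (norm (x - x0))\<^sup>2
        = (p + q) \<bullet> (x - x0) + ((norm p)\<^sup>2 + (norm q)\<^sup>2) / 4"
    proof -
      have "(norm (x + v /\<^sub>R 2 - x0))\<^sup>2 = (norm (x - x0))\<^sup>2 + v \<bullet> (x - x0) + (norm v)\<^sup>2 / 4" for v
      proof -
        have "x + v /\<^sub>R 2 - x0 = (x - x0) + v /\<^sub>R 2" by simp
        then show ?thesis
          by (simp only: power2_norm_eq_inner inner_add_left inner_add_right inner_scaleR_left
              inner_scaleR_right inner_commute[of "x - x0" v]) (simp add: field_simps)
      qed
      then show ?thesis unfolding y_def z_def by (simp add: inner_add_left)
    qed
    \<comment> \<open>The ball about \<open>y\<close> contains \<open>x\<close> and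
      \<open>y2\<close>, the ball about \<open>z\<close> contains \<open>x\<close> and
      \<open>z2\<close>. Passing through \<open>u x\<close> thus bounds the oscillation at scale
      \<open>2 * \<epsilon>\<close> by two at scale \<open>\<epsilon>\<close>.\<close>
    have "u y2 - u x \<le> 2 * \<epsilon> * ?W y \<epsilon>" "u x - u z2 \<le> 2 * \<epsilon> * ?W z \<epsilon>"
      using diff_le_osc_slope[OF cu[OF yzX(1) \<epsilon>R] \<epsilon>] diff_le_osc_slope[OF cu[OF yzX(2) \<epsilon>R] \<epsilon>]
        in_y in_z by auto
    then have "2 * \<epsilon> * (2 * ?W x (2 * \<epsilon>)) \<le> 2 * \<epsilon> * (?W y \<epsilon> + ?W z \<epsilon>)"
      using yz2(3) by (simp add: algebra_simps)
    then have "2 * ?W x (2 * \<epsilon>) \<le> ?W y \<epsilon> + ?W z \<epsilon>" using \<epsilon> by simp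
    moreover have "F \<epsilon> y \<le> F \<epsilon> x + \<theta>" "F \<epsilon> z \<le> F \<epsilon> x + \<theta>"
      using F_le_A[OF \<epsilon> \<epsilon>R yzX(1)] F_le_A[OF \<epsilon> \<epsilon>R yzX(2)] x(2) by linarith+
    moreover have "K * ((norm (y - x0))\<^sup>2 + (norm (z - x0))\<^sup>2 - 2 * (norm (x - x0))\<^sup>2)
        = K * (norm (y - x0))\<^sup>2 + K * (norm (z - x0))\<^sup>2 - 2 * (K * (norm (x - x0))\<^sup>2)"
      by (simp add: algebra_simps)
    ultimately have "2 * d * \<epsilon> \<le> K * ((p + q) \<bullet> (x - x0) + ((norm p)\<^sup>2 + (norm q)\<^sup>2) / 4) + 2 * \<theta>"
      using gain unfolding F_def w_def sq by linarith
    also have "\<dots> \<le> K * (norm (p + q) * R + 2 * \<epsilon>\<^sup>2) + 2 * \<theta>"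
    proof -
      have "(p + q) \<bullet> (x - x0) \<le> norm (p + q) * norm (x - x0)" by (rule norm_cauchy_schwarz)
      also have "\<dots> \<le> norm (p + q) * R" using xR R by (intro mult_left_mono) auto
      finally have "(p + q) \<bullet> (x - x0) \<le> norm (p + q) * R" .
      moreover have "((norm p)\<^sup>2 + (norm q)\<^sup>2) / 4 \<le> 2 * \<epsilon>\<^sup>2"
        using power_mono[OF pq(1), of 2] power_mono[OF pq(2), of 2] by (simp add: power_mult_distrib)
      ultimately have "(p + q) \<bullet> (x - x0) + ((norm p)\<^sup>2 + (norm q)\<^sup>2) / 4 \<le> norm (p + q) * R + 2 * \<epsilon>\<^sup>2"
        by (rule add_mono)
      then show ?thesis using K by simp
    qed
    finally have "2 * d * \<epsilon> \<le> K * R * norm (p + q) + 2 * (K * \<epsilon>) * \<epsilon> + 2 * \<theta>"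
      by (simp add: algebra_simps power2_eq_square)
    moreover have "4 * K * \<epsilon> * \<epsilon> \<le> d * \<epsilon>" using \<epsilon>_le(3) \<epsilon> by (intro mult_right_mono) auto
    ultimately have "d * \<epsilon> \<le> K * R * norm (p + q)" unfolding \<theta>_def by (simp add: algebra_simps)
    then show ?thesis unfolding \<kappa>_def using K R by (simp add: field_simps)
  qed
  \<comment> \<open>Since \<open>w\<close> is nearly the local Lipschitz constant, the extremal points are nearly antipodal.\<close>
  define D where "D = norm (p - q)"
  have "4 * \<epsilon> * w \<le> D * (w + 3 * \<eta>)"
  proof -
    \<comment> \<open>The midpoint of the two extremal points: its ball of radius
      \<open>D / 2\<close> contains both, so the full oscillation is at most \<open>D\<close> times
      a slope at \<open>m\<close>. That slope is then raised to radius \<open>r\<close> and compared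
      with \<open>w\<close> through \<open>A r\<close>.\<close>
    define m where "m = x + (p + q) /\<^sub>R 2"
    have nm: "norm (m - x) \<le> 2 * \<epsilon>"
      using norm_triangle_ineq[of p q] pq unfolding m_def by simp
    have mX: "m \<in> cball x0 R" by (rule near[OF nm])
    have ym: "y2 - m = (p - q) /\<^sub>R 2" "z2 - m = - ((p - q) /\<^sub>R 2)"
      unfolding m_def yz2_eq using half[of p] half[of q]
      by (simp_all add: scaleR_add_right scaleR_diff_right algebra_simps)
    have D: "0 \<le> D" "D \<le> 4 * \<epsilon>" "D / 2 \<le> r" using norm_triangle_ineq4[of p q] pq \<epsilon>_le unfolding D_def by auto
    have "u y2 - u z2 \<le> D * ?W m r"
    proof (cases "D = 0")
      case True
      then have "y2 = z2" unfolding D_def p_def q_def by simp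
      then show ?thesis using True by simp
    next
      case False
      have "y2 \<in> cball m (D / 2)" "z2 \<in> cball m (D / 2)"
        unfolding mem_cball dist_norm norm_minus_commute[of m] ym by (auto simp: D_def)
      moreover have "D / 2 \<le> R" using D(3) r by linarith
      ultimately have "u y2 - u z2 \<le> 2 * (D / 2) * ?W m (D / 2)"
        using False D by (intro diff_le_osc_slope cu mX) auto
      also have "\<dots> \<le> D * ?W m r"
        using mono[OF mX _ D(3) r(2)] False D by (auto intro!: mult_left_mono)
      finally show ?thesis .
    qed
    also have "\<dots> \<le> D * (w + 3 * \<eta>)"
    proof (rule mult_left_mono)
      have tri: "norm (m - x0) \<le> norm (x - x0) + 2 * \<epsilon>"
        using norm_triangle_ineq[of "m - x" "x - x0"] nm by simp
      have "(norm (m - x0))\<^sup>2 - (norm (x - x0))\<^sup>2 = (norm (m - x0) - norm (x - x0)) * (norm (m - x0) + norm (x - x0))"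
        by (simp add: power2_eq_square algebra_simps)
      also have "\<dots> \<le> 2 * \<epsilon> * (2 * R)"
        using tri mX x(1) \<epsilon> R by (intro mult_mono) (auto simp: dist_norm norm_minus_commute)
      finally have "K * ((norm (m - x0))\<^sup>2 - (norm (x - x0))\<^sup>2) \<le> K * (2 * \<epsilon> * (2 * R))"
        using K by (intro mult_left_mono) auto
      then have "K * (norm (m - x0))\<^sup>2 - K * (norm (x - x0))\<^sup>2 \<le> \<eta>"
        using \<epsilon>_le(4) by (simp add: algebra_simps)
      moreover have "F r m \<le> A r" using F_le_A r mX by simp
      moreover have "A r \<le> F \<epsilon> x + \<theta> + \<eta>" using A_r[OF \<epsilon> \<epsilon>R] x(2) by linarith
      ultimately show "?W m r \<le> w + 3 * \<eta>" using \<theta> unfolding F_def w_def by linarith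
    qed (use D in simp)
    finally have "2 * (2 * \<epsilon>) * ?W x (2 * \<epsilon>) \<le> D * (w + 3 * \<eta>)" unfolding yz2(3) .
    moreover have "4 * \<epsilon> * w \<le> 4 * \<epsilon> * ?W x (2 * \<epsilon>)"
      using gain d \<epsilon> by (intro mult_left_mono) (auto intro: order_trans[rotated])
    ultimately show ?thesis by simp
  qed
  moreover have D: "0 \<le> D" "D \<le> 4 * \<epsilon>" using norm_triangle_ineq4[of p q] pq unfolding D_def by auto
  moreover have "D * (3 * \<eta>) \<le> 4 * \<epsilon> * (3 * \<eta>)" using D \<eta>(1) by (intro mult_right_mono) auto
  ultimately have "(4 * \<epsilon> - D) * w \<le> 12 * \<epsilon> * \<eta>" by (simp add: algebra_simps)
  moreover have "(4 * \<epsilon> - D) * (\<Lambda> / 2) \<le> (4 * \<epsilon> - D) * w" using w D by (intro mult_left_mono) auto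
  ultimately have "(4 * \<epsilon> - D) * \<Lambda> \<le> 24 * \<epsilon> * \<eta>" by (simp add: algebra_simps)
  moreover have "24 * \<epsilon> * \<eta> \<le> 24 * \<epsilon> * (\<Lambda> * \<kappa>\<^sup>2 / 400)" using \<eta> \<epsilon> by (intro mult_left_mono) auto
  ultimately have "\<Lambda> * (4 * \<epsilon> - D) \<le> \<Lambda> * (24 * \<epsilon> * \<kappa>\<^sup>2 / 400)" by (simp add: algebra_simps)
  then have anti: "4 * \<epsilon> - D \<le> 24 * \<epsilon> * \<kappa>\<^sup>2 / 400" using \<Lambda> by simp
  \<comment> \<open>The parallelogram law turns a separation \<open>D\<close> close to its maximum
    \<open>4 * \<epsilon>\<close> into smallness of \<open>p + q\<close>, contradicting
    \<open>lower\<close>.\<close>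
  have "(norm (p + q))\<^sup>2 = 2 * (norm p)\<^sup>2 + 2 * (norm q)\<^sup>2 - D\<^sup>2"
    unfolding D_def power2_norm_eq_inner by (simp add: inner_add inner_diff inner_commute algebra_simps)
  also have "\<dots> \<le> (4 * \<epsilon>)\<^sup>2 - D\<^sup>2"
    using power_mono[OF pq(1), of 2] power_mono[OF pq(2), of 2] by (simp add: power2_eq_square)
  also have "\<dots> = (4 * \<epsilon> - D) * (4 * \<epsilon> + D)" by (simp add: power2_eq_square algebra_simps)
  also have "\<dots> \<le> (24 * \<epsilon> * \<kappa>\<^sup>2 / 400) * (8 * \<epsilon>)"
    using anti D \<epsilon> by (intro mult_mono) auto
  also have "\<dots> < (\<kappa> * \<epsilon>)\<^sup>2" using \<kappa> \<epsilon> by (simp add: power2_eq_square)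
  also have "\<dots> \<le> (norm (p + q))\<^sup>2" using lower \<kappa> \<epsilon> by (intro power_mono) auto
  finally show False by simp
qed

section \<open>Ordering of the right-hand sides and the final equality\<close>

text \<open>For smooth \<open>u\<close> the two inequalities bound the same quantity from both
  sides; for merely continuous \<open>u\<close> the slope argument replaces this. Since each
  equation supplies one side, using the lemma with both assignments of \<open>f\<close> and
  \<open>g\<close> gives equality.\<close>

lemma visc_sub_super_running_cost_le:
  fixes \<Omega> :: "(real^'n) set"
  assumes op: "open \<Omega>" and bd: "bounded \<Omega>" and h: "continuous_on \<Omega> h" and h': "continuous_on \<Omega> h'"
    and sub: "visc_sub \<Omega> h u" and sup: "visc_super \<Omega> h' u" and x1: "x1 \<in> \<Omega>"
  shows "h' x1 \<le> h x1"
proof (rule ccontr)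
  assume lt: "\<not> h' x1 \<le> h x1"
  \<comment> \<open>Each side gives up a quarter of the gap, so half of it remains in
    \<open>c - c'\<close> on a neighbourhood of \<open>x1\<close>.\<close>
  define \<gamma> where "\<gamma> = (h' x1 - h x1) / 4"
  have \<gamma>: "\<gamma> > 0" unfolding \<gamma>_def using lt by simp
  define c where "c = - h x1 - \<gamma>"
  define c' where "c' = - h' x1 + \<gamma>"
  have "isCont h x1" "isCont h' x1"
    using h h' op x1 by (auto simp: continuous_on_eq_continuous_at)
  then obtain s1 s2 where s12: "s1 > 0" "\<And>y. dist y x1 < s1 \<Longrightarrow> dist (h y) (h x1) < \<gamma>"
    "s2 > 0" "\<And>y. dist y x1 < s2 \<Longrightarrow> dist (h' y) (h' x1) < \<gamma>"
    using \<gamma> unfolding continuous_at_eps_delta by metis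
  obtain s3 where s3: "s3 > 0" "ball x1 s3 \<subseteq> \<Omega>" using op x1 open_contains_ball by blast
  \<comment> \<open>A ball is convex, so a function with zero derivative on it is constant.\<close>
  define U where "U = ball x1 (min s1 (min s2 s3))"
  have U: "open U" "x1 \<in> U" "U \<subseteq> \<Omega>" unfolding U_def using s12 s3 by auto
  have c: "c < - h y" and c': "- h' y < c'" if "y \<in> U" for y
    using s12(2)[of y] s12(4)[of y] that unfolding U_def c_def c'_def
    by (auto simp: dist_commute dist_real_def)
  define d where "d = (c - c') / 4"
  have d: "d > 0" unfolding d_def c_def c'_def using \<gamma> unfolding \<gamma>_def by (simp add: field_simps)
  have growth: "osc_slope u x \<rho> + d * (r - \<rho>) \<le> osc_slope u x r"
    if "cball x r \<subseteq> U" "0 < \<rho>" "\<rho> \<le> r" for x \<rho> r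
    unfolding d_def
    by (rule visc_osc_slope_growth[OF op bd sub sup _ that(2,3)]) (use that U c c' in blast)+
  have cu: "continuous_on U u"
    using sub U unfolding visc_sub_def by (blast intro: continuous_on_subset)
  \<comment> \<open>If no such centre existed, every point would have arbitrarily small slopes at
    some radius. Monotonicity carries this to all smaller radii, so the derivative of
    \<open>u\<close> would vanish throughout \<open>U\<close>.\<close>
  have "\<exists>x0\<in>U. \<exists>\<Lambda>>0. \<forall>r>0. cball x0 r \<subseteq> U \<longrightarrow> \<Lambda> \<le> osc_slope u x0 r"
  proof (rule ccontr)
    assume "\<not> ?thesis"
    then have flat: "\<exists>r>0. cball x r \<subseteq> U \<and> osc_slope u x r < \<Lambda>" if "x \<in> U" "\<Lambda> > 0" for x \<Lambda>
      using that by (meson not_le)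
    have "(u has_derivative (\<lambda>v. 0)) (at x within U)" if x: "x \<in> U" for x
      unfolding has_derivative_within_alt
    proof (intro conjI allI impI)
      fix e :: real assume e: "e > 0"
      then obtain r where r: "r > 0" "cball x r \<subseteq> U" "osc_slope u x r < e / 2"
        using flat[OF x, of "e / 2"] by auto
      have "norm (u y - u x - 0) \<le> e * norm (y - x)" if y: "norm (y - x) < r" for y
      proof (cases "y = x")
        case False
        define \<rho> where "\<rho> = norm (y - x)"
        have \<rho>: "0 < \<rho>" "\<rho> \<le> r" using False y unfolding \<rho>_def by auto
        have cb: "cball x \<rho> \<subseteq> U" using r \<rho> by (meson order_trans subset_cball)
        have in_cb: "y \<in> cball x \<rho>" "x \<in> cball x \<rho>"
          unfolding \<rho>_def by (auto simp: dist_norm norm_minus_commute)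
        have "\<bar>u y - u x\<bar> \<le> 2 * \<rho> * osc_slope u x \<rho>"
          using diff_le_osc_slope[OF continuous_on_subset[OF cu cb] \<rho>(1)] in_cb
          by (metis abs_le_iff minus_diff_eq)
        also have "\<dots> \<le> 2 * \<rho> * (e / 2)"
        proof (rule mult_left_mono)
          have "d * (r - \<rho>) \<ge> 0" using d \<rho> by simp
          then show "osc_slope u x \<rho> \<le> e / 2" using growth[OF r(2) \<rho>] r(3) by linarith
        qed (use \<rho> in simp)
        finally show ?thesis unfolding \<rho>_def by (simp add: mult_ac)
      qed simp
      then show "\<exists>d>0. \<forall>y\<in>U. norm (y - x) < d \<longrightarrow> norm (u y - u x - 0) \<le> e * norm (y - x)"
        using r(1) by blast
    qed simp
    then obtain k where k: "\<And>x. x \<in> U \<Longrightarrow> u x = k"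
      using has_derivative_zero_constant[of U u] unfolding U_def by (metis convex_ball)
    obtain t where t: "t > 0" "ball x1 t \<subseteq> U" using U open_contains_ball by blast
    \<comment> \<open>Constants touch the locally constant \<open>u\<close> from both sides. As
      \<open>\<theta>\<close> multiplies a zero second derivative, this gives
      \<open>h' x1 \<le> 0 \<le> h x1\<close>, against the assumption.\<close>
    have "\<exists>\<theta>\<in>{0..(norm (x1 - x1))\<^sup>2}. - h x1 \<le> 4 * \<theta> * 0"
      by (rule visc_sub_radial_test(2)[OF op bd sub x1 DERIV_const[of k] DERIV_const[of 0]
            continuous_on_const t(1)]) (use k t U in auto)
    moreover have "\<exists>\<theta>\<in>{0..(norm (x1 - x1))\<^sup>2}. - (- h' x1) \<le> 4 * \<theta> * 0"
      by (rule visc_sub_radial_test(2)[OF op bd visc_super_imp_visc_sub_uminus[OF sup] x1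
            DERIV_const[of "- k"] DERIV_const[of 0] continuous_on_const t(1)]) (use k t U in auto)
    ultimately show False using lt by simp
  qed
  then obtain x0 \<Lambda> where x0: "x0 \<in> U" "\<Lambda> > 0"
    "\<And>r. 0 < r \<Longrightarrow> cball x0 r \<subseteq> U \<Longrightarrow> \<Lambda> \<le> osc_slope u x0 r" by blast
  obtain t where t: "t > 0" "cball x0 t \<subseteq> U" using U x0(1) open_contains_cball by blast
  define R where "R = t / 2"
  have R: "R > 0" "cball x0 (2 * R) \<subseteq> U" using t unfolding R_def by auto
  have sub': "cball x r \<subseteq> U" if "x \<in> cball x0 R" "r \<le> R" for x r
  proof
    fix v assume "v \<in> cball x r"
    then have "v \<in> cball x0 (2 * R)" using that dist_triangle[of x0 v x] by auto
    then show "v \<in> U" using R by blast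
  qed
  show False
  proof (rule osc_slope_growth_contradiction[OF R(1) d x0(2)])
    show "continuous_on (cball x0 (2 * R)) u" using cu R by (blast intro: continuous_on_subset)
    show "osc_slope u x \<rho> + d * (r - \<rho>) \<le> osc_slope u x r"
      if "x \<in> cball x0 R" "0 < \<rho>" "\<rho> \<le> r" "r \<le> R" for x \<rho> r
      using growth sub' that by blast
    show "\<Lambda> \<le> osc_slope u x0 r" if "0 < r" "r \<le> R" for r
      using x0(3) sub'[of x0 r] that R by simp
  qed
qed

theorem theorem1p2:
  fixes \<Omega> :: "(real^'n) set" and f g u :: "real^'n \<Rightarrow> real"
  assumes "open \<Omega>" and "bounded \<Omega>"
    and "continuous_on \<Omega> f" and "continuous_on \<Omega> g" and "continuous_on \<Omega> u"
    and "visc_sol \<Omega> g u" and "visc_sol \<Omega> f u"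
  shows "\<forall>x\<in>\<Omega>. f x = g x"
proof
  fix x assume x: "x \<in> \<Omega>"
  have "g x \<le> f x" "f x \<le> g x"
    using visc_sub_super_running_cost_le[OF assms(1,2) _ _ _ _ x] assms(3-7)
    unfolding visc_sol_def by blast+
  then show "f x = g x" by simp
qed

end
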